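(* Let $\mathbb{F}$ be a field and let $\mathbf{L}=\mathbf{V}\rtimes\mathbb{F}e_0$ be an almost Abelian Lie algebra over $\mathbb{F}$. (A) The Lie subalgebras $\mathbf{L}_0\subset\mathbf{L}$ are exactly the subspaces of one of the following forms: (1) an Abelian Lie subalgebra $\mathbf{L}_0=\mathbf{W}$ with any subspace $\mathbf{W}\subset\mathbf{V}$; (2) an Abelian Lie subalgebra $\mathbf{L}_0=\mathbf{W}\oplus\mathbb{F}e_1$ with any $e_1\in e_0+\mathbf{V}$ and any subspace $\mathbf{W}\subset\ker\mathrm{ad}_{e_0}$; (3) an almost Abelian Lie subalgebra $\mathbf{L}_0=\mathbf{W}\rtimes\mathbb{F}e_1$ with any $e_1\in e_0+\mathbf{V}$ and any $\mathrm{ad}_{e_0}$-invariant subspace $\mathbf{W}\subset\mathbf{V}$ with $\mathbf{W}\not\subset\ker\mathrm{ad}_{e_0}$. (B) The ideals $\mathbf{I}\subset\mathbf{L}$ are exactly the subspaces of one of the following forms: (1) an Abelian ideal $\mathbf{I}=\mathbf{W}$ with any $\mathrm{ad}_{e_0}$-invariant subspace $\mathbf{W}\subset\mathbf{V}$; (2) an Abelian ideal $\mathbf{I}=\mathbf{W}\oplus\mathbb{F}e_1$ with any $e_1\in e_0+\mathbf{V}$ and any subspace $\mathbf{W}\subset\ker\mathrm{ad}_{e_0}$ with $\mathrm{ad}_{e_0}\mathbf{V}\subset\mathbf{W}$; (3) an almost Abelian ideal $\mathbf{I}=\mathbf{W}\rtimes\mathbb{F}e_1$ with any $e_1\in e_0+\mathbf{V}$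 and any subspace $\mathbf{W}\subset\mathbf{V}$ with $\mathrm{ad}_{e_0}\mathbf{V}\subset\mathbf{W}$ and $\mathbf{W}\not\subset\ker\mathrm{ad}_{e_0}$.
   Context: An almost Abelian Lie algebra over a field $\mathbb{F}$ (of arbitrary, possibly infinite, dimension) is a non-Abelian Lie algebra that contains a codimension 1 Abelian subalgebra. Such an algebra has a codimension 1 Abelian ideal. Writing $\mathbf{L}=\mathbf{V}\rtimes\mathbb{F}e_0$ means: $\mathbf{V}\subset\mathbf{L}$ is a codimension 1 Abelian ideal, $e_0\in\mathbf{L}\setminus\mathbf{V}$, and $\mathbf{L}=\mathbf{V}\oplus\mathbb{F}e_0$ as vector spaces. The operator $\mathrm{ad}_{e_0}\in\mathrm{End}_{\mathbb{F}}(\mathbf{V})$ is $v\mapsto[e_0,v]$ (so $\ker\mathrm{ad}_{e_0}\subset\mathbf{V}$); it is nonzero. Subspaces $\mathbf{W}$ may be zero. $\mathbf{W}\oplus\mathbb{F}e_1$ denotes a direct sum of commuting Lie subalgebras, and $\mathbf{W}\rtimes\mathbb{F}e_1$ the vector space direct sum with $\mathbf{W}$ an Abelian ideal in it, with the bracket inherited from $\mathbf{L}$. *)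

theory Defs
  imports Complex_Main "HOL-Library.Set_Algebras"
begin

text \<open>
  The whole type \<open>'b\<close> is the ambient Lie algebra. The bracket is alternating, not merely
  antisymmetric, so that characteristic 2 is covered.
\<close>
locale lie_algebra = vector_space scale
  for scale :: "'a::field \<Rightarrow> 'b::ab_group_add \<Rightarrow> 'b" +
  fixes bracket :: "'b \<Rightarrow> 'b \<Rightarrow> 'b"
  assumes bracket_add_left: "bracket (x + y) z = bracket x z + bracket y z"
    and bracket_add_right: "bracket x (y + z) = bracket x y + bracket x z"
    and bracket_scale_left: "bracket (scale c x) y = scale c (bracket x y)"
    and bracket_scale_right: "bracket x (scale c y) = scale c (bracket x y)"
    and bracket_self: "bracket x x = 0"
    and jacobi: "bracket x (bracket y z) + bracket y (bracket z x) + bracket z (bracket x y) = 0"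
begin

definition direct_sum :: "'b set \<Rightarrow> 'b set \<Rightarrow> 'b set \<Rightarrow> bool"
  where "direct_sum L A B \<longleftrightarrow> subspace A \<and> subspace B \<and> A \<inter> B = {0} \<and> L = A + B"

text \<open>
  The library has no quotient spaces; the codimension of \<open>A\<close> in \<open>L\<close> is the dimension of a linear
  complement. Since \<^const>\<open>dim\<close> is \<open>0\<close> on infinite-dimensional subspaces, \<open>dim B = 1\<close> does mean that
  \<open>B\<close> is a line, and \<open>L\<close> itself may have any dimension.
\<close>
definition codim1 :: "'b set \<Rightarrow> 'b set \<Rightarrow> bool"
  where "codim1 A L \<longleftrightarrow> (\<exists>B. direct_sum L A B \<and> dim B = 1)"

definition subalgebra :: "'b set \<Rightarrow> bool"
  where "subalgebra S \<longleftrightarrow> subspace S \<and> (\<forall>x\<in>S. \<forall>y\<in>S. bracket x y \<in> S)"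

definition ideal :: "'b set \<Rightarrow> 'b set \<Rightarrow> bool"
  where "ideal I L \<longleftrightarrow> subspace I \<and> I \<subseteq> L \<and> (\<forall>x\<in>L. \<forall>y\<in>I. bracket x y \<in> I)"

definition abelian :: "'b set \<Rightarrow> bool"
  where "abelian S \<longleftrightarrow> (\<forall>x\<in>S. \<forall>y\<in>S. bracket x y = 0)"

definition almost_abelian :: "'b set \<Rightarrow> bool"
  where "almost_abelian L \<longleftrightarrow> subalgebra L \<and> \<not> abelian L \<and>
    (\<exists>A. subalgebra A \<and> A \<subseteq> L \<and> abelian A \<and> codim1 A L)"

text \<open>\<open>L = A \<oplus> B\<close> as a direct sum of commuting Lie subalgebras.\<close>
definition lie_direct_sum :: "'b set \<Rightarrow> 'b set \<Rightarrow> 'b set \<Rightarrow> bool"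
  where "lie_direct_sum L A B \<longleftrightarrow> subalgebra A \<and> subalgebra B \<and>
    (\<forall>a\<in>A. \<forall>b\<in>B. bracket a b = 0) \<and> direct_sum L A B"

text \<open>\<open>L = W \<rtimes> \<bbbF> e\<close>, with the bracket of the ambient algebra.\<close>
definition semidirect :: "'b set \<Rightarrow> 'b set \<Rightarrow> 'b \<Rightarrow> bool"
  where "semidirect L W e \<longleftrightarrow> subalgebra L \<and> ideal W L \<and> abelian W \<and> codim1 W L \<and>
    e \<in> L - W \<and> direct_sum L W (span {e})"

definition ad :: "'b \<Rightarrow> 'b \<Rightarrow> 'b"
  where "ad e v = bracket e v"

text \<open>The kernel of \<open>ad e\<close> as an operator on \<open>V\<close>; on the whole algebra it would also contain \<open>e\<close>.\<close>
definition ker_ad :: "'b set \<Rightarrow> 'b \<Rightarrow> 'b set"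
  where "ker_ad V e = {v \<in> V. ad e v = 0}"

end

end

theory Submission
  imports Defs
begin

text \<open>
  Everything follows from one formula. Since \<open>V\<close> is Abelian, brackets with an element of \<open>V\<close> do not
  change when \<open>e\<^sub>0\<close> is replaced by any \<open>e \<in> e\<^sub>0 + V\<close>, and so
  \<open>[u + a e, v + b e] = a (ad e\<^sub>0 v) - b (ad e\<^sub>0 u)\<close> for \<open>u, v \<in> V\<close> (lemma \<open>bracket_decomposed\<close>). In particular every bracket lies in \<open>V\<close>.

  A subspace is either contained in \<open>V\<close>, or it contains an element outside \<open>V\<close>, which after rescaling
  is some \<open>e \<in> e\<^sub>0 + V\<close>; subtracting multiples of \<open>e\<close> shows that the subspace is then \<open>W \<oplus> \<bbbF>e\<close>
  with \<open>W\<close> its intersection with \<open>V\<close> (lemma \<open>subspace_cases\<close>). So it remains to decide, for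
  subspaces of these two shapes, what closure under brackets and commutativity mean, and the formula
  answers this directly: \<open>W \<oplus> \<bbbF>e\<close> is a subalgebra iff \<open>W\<close> is invariant under \<open>ad e\<^sub>0\<close>, an ideal iff \<open>W\<close>
  contains \<open>ad e\<^sub>0 V\<close>, and Abelian iff \<open>ad e\<^sub>0\<close> vanishes on \<open>W\<close>. The
  conditions on \<open>W\<close> are forced by the products \<open>[e, v] = ad e\<^sub>0 v\<close>: these lie in \<open>V\<close> and hence, if they
  lie in \<open>W \<oplus> \<bbbF>e\<close> at all, in \<open>W\<close>. The Abelian and the almost Abelian forms outside \<open>V\<close> are then
  separated by whether \<open>W\<close> lies in the kernel of \<open>ad e\<^sub>0\<close>.
\<close>

section \<open>Brackets and sums with a line\<close>

context lie_algebra
begin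

lemma bracket_skew: "bracket x y = - bracket y x"
proof -
  have "bracket (x + y) (x + y) = bracket x y + bracket y x"
    by (simp add: bracket_add_left bracket_add_right bracket_self[of x] bracket_self[of y])
  then show ?thesis
    using bracket_self[of "x + y"] by (simp add: eq_neg_iff_add_eq_0)
qed

lemma mem_plus_line_iff: "x \<in> W + span {e} \<longleftrightarrow> (\<exists>w\<in>W. \<exists>c. x = w + scale c e)"
  by (auto simp: set_plus_def span_singleton)

end

section \<open>Subspaces relative to a decomposition of the algebra\<close>

locale semidirect_decomposition = lie_algebra +
  fixes V :: "'b set" and e0 :: 'b
  assumes decomposition: "semidirect UNIV V e0"
begin

lemma subspace_V: "subspace V"
  and V_commute: "u \<in> V \<Longrightarrow> v \<in> V \<Longrightarrow> bracket u v = 0"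
  and bracket_in_V: "v \<in> V \<Longrightarrow> bracket x v \<in> V"
  and e0_notin_V: "e0 \<notin> V"
  using decomposition by (auto simp: semidirect_def ideal_def abelian_def)

lemma ad_in_V: "v \<in> V \<Longrightarrow> ad e0 v \<in> V"
  by (simp add: ad_def bracket_in_V)

lemma e0_in_coset: "e0 \<in> e0 +o V"
  using subspace_0[OF subspace_V] by (force simp: elt_set_plus_def)

lemma coset_notin_V:
  assumes "e \<in> e0 +o V"
  shows "e \<notin> V"
proof
  assume "e \<in> V"
  moreover obtain t where "t \<in> V" "e = e0 + t"
    using assms by (auto simp: elt_set_plus_def)
  ultimately show False
    using subspace_diff[OF subspace_V, of e t] e0_notin_V by simp
qed

lemma mem_V_plus_line:
  assumes "e \<in> e0 +o V"
  shows "x \<in> V + span {e}"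
proof -
  have "x \<in> V + span {e0}"
    using decomposition by (auto simp: semidirect_def direct_sum_def)
  then obtain v c where v: "v \<in> V" "x = v + scale c e0"
    by (auto simp: mem_plus_line_iff)
  obtain t where t: "t \<in> V" "e = e0 + t"
    using assms by (auto simp: elt_set_plus_def)
  have "x = (v - scale c t) + scale c e"
    using v t by (simp add: scale_right_distrib)
  moreover have "v - scale c t \<in> V"
    using v t subspace_V by (simp add: subspace_diff subspace_scale)
  ultimately show ?thesis
    unfolding mem_plus_line_iff by blast
qed

lemma decompose:
  assumes "e \<in> e0 +o V"
  obtains v c where "v \<in> V" "x = v + scale c e"
  using mem_V_plus_line[OF assms, of x] by (auto simp: mem_plus_line_iff)

lemma multiple_in_V_iff:
  assumes "e \<in> e0 +o V"
  shows "scale c e \<in> V \<longleftrightarrow> c = 0"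
proof
  assume "scale c e \<in> V"
  then have "scale (inverse c) (scale c e) \<in> V"
    using subspace_V by (simp add: subspace_scale del: scale_scale)
  then show "c = 0"
    using coset_notin_V[OF assms] by (cases "c = 0") auto
qed (simp add: subspace_V subspace_0)

lemma mem_plus_line_in_V_iff:
  assumes e: "e \<in> e0 +o V" and W: "W \<subseteq> V" and v: "v \<in> V"
  shows "v \<in> W + span {e} \<longleftrightarrow> v \<in> W"
proof
  assume "v \<in> W + span {e}"
  then obtain w c where w: "w \<in> W" "v = w + scale c e"
    by (auto simp: mem_plus_line_iff)
  then have "scale c e \<in> V"
    using subspace_diff[OF subspace_V v, of w] W by auto
  then show "v \<in> W"
    using w multiple_in_V_iff[OF e] by simp
next
  assume "v \<in> W"
  then show "v \<in> W + span {e}"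
    unfolding mem_plus_line_iff by (intro bexI exI[of _ 0]) auto
qed

text \<open>
  The classification states its subspaces as sums \<open>W + \<bbbF>e\<close>; that such sums are direct is a
  consequence of \<open>e \<notin> V\<close>.
\<close>
lemma direct_sum_line:
  assumes e: "e \<in> e0 +o V" and W: "subspace W" "W \<subseteq> V"
  shows "direct_sum (W + span {e}) W (span {e})"
proof -
  have "x = 0" if "x \<in> W" "x \<in> span {e}" for x
  proof -
    obtain c where c: "x = scale c e"
      using \<open>x \<in> span {e}\<close> by (auto simp: span_singleton)
    with \<open>x \<in> W\<close> W(2) have "scale c e \<in> V"
      by auto
    then show ?thesis
      by (simp add: c multiple_in_V_iff[OF e] del: scale_eq_0_iff)
  qed
  then have "W \<inter> span {e} = {0}"
    using subspace_0[OF W(1)] span_zero by blast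
  then show ?thesis
    using W by (simp add: direct_sum_def)
qed

lemma subspace_plus_line:
  assumes "subspace W"
  shows "subspace (W + span {e})"
proof -
  have "W + span {e} = {x + y |x y. x \<in> W \<and> y \<in> span {e}}"
    unfolding set_plus_def by blast
  then show ?thesis
    using subspace_sums[OF assms subspace_span] by simp
qed

lemma codim1_line:
  assumes e: "e \<in> e0 +o V" and W: "subspace W" "W \<subseteq> V"
  shows "codim1 W (W + span {e})"
proof -
  have "e \<noteq> 0"
    using coset_notin_V[OF e] subspace_V subspace_0 by auto
  then have "dim (span {e}) = 1"
    using dim_span_eq_card_independent[of "{e}"] by simp
  then show ?thesis
    using direct_sum_line[OF assms] by (auto simp: codim1_def)
qed

text \<open>
  Since \<open>V\<close> and \<open>e\<^sub>0\<close> span the algebra, an element of \<open>S\<close> outside \<open>V\<close> is \<open>v + c e\<^sub>0\<close> with \<open>v \<in> V\<close> and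
  \<open>c \<noteq> 0\<close>; dividing by \<open>c\<close> puts it into the coset \<open>e\<^sub>0 + V\<close>. Any other element of \<open>S\<close> differs from an element of \<open>V\<close> by
  a multiple of it, and this element of \<open>V\<close> is again in \<open>S\<close>, so \<open>W = S \<inter> V\<close> works.
\<close>
lemma subspace_cases:
  assumes S: "subspace S"
  obtains (inside) "S \<subseteq> V"
  | (outside) e W where "e \<in> e0 +o V" "subspace W" "W \<subseteq> V" "S = W + span {e}"
proof (cases "S \<subseteq> V")
  case False
  then obtain x where x: "x \<in> S" "x \<notin> V"
    by auto
  obtain v c where v: "v \<in> V" "x = v + scale c e0"
    using decompose[OF e0_in_coset] .
  define e where "e = scale (inverse c) x"
  have "c \<noteq> 0"
    using x v by auto
  then have "e = e0 + scale (inverse c) v"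
    by (simp add: e_def v scale_right_distrib add.commute)
  then have e: "e \<in> e0 +o V"
    using v subspace_V by (auto simp: elt_set_plus_def subspace_scale)
  have "e \<in> S"
    using x S by (simp add: e_def subspace_scale)
  have "S = (S \<inter> V) + span {e}"
  proof (intro set_eqI iffI)
    fix y assume "y \<in> S"
    obtain u d where u: "u \<in> V" "y = u + scale d e"
      using decompose[OF e] .
    then have "u \<in> S"
      using subspace_diff[OF S \<open>y \<in> S\<close> subspace_scale[OF S \<open>e \<in> S\<close>, of d]] by simp
    with u show "y \<in> (S \<inter> V) + span {e}"
      unfolding mem_plus_line_iff by blast
  next
    fix y assume "y \<in> (S \<inter> V) + span {e}"
    then show "y \<in> S"
      using S \<open>e \<in> S\<close> by (auto simp: mem_plus_line_iff subspace_add subspace_scale)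
  qed
  then show thesis
    using outside[OF e, of "S \<inter> V"] subspace_inter[OF S subspace_V] by blast
qed (rule inside)

section \<open>Brackets in the two shapes of subspace\<close>

text \<open>
  This is why the conditions on \<open>W\<close> in the classification involve \<open>ad e\<^sub>0\<close> only, whatever generator
  \<open>e\<close> is chosen.
\<close>
lemma bracket_coset:
  assumes "e \<in> e0 +o V" "v \<in> V"
  shows "bracket e v = ad e0 v"
  using assms by (auto simp: elt_set_plus_def bracket_add_left V_commute ad_def)

lemma bracket_decomposed:
  assumes e: "e \<in> e0 +o V" and u: "u \<in> V" and v: "v \<in> V"
  shows "bracket (u + scale a e) (v + scale b e) = scale a (ad e0 v) - scale b (ad e0 u)"
proof -
  have "bracket u e = - ad e0 u"
    using bracket_skew[of u e] bracket_coset[OF e u] by simp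
  then show ?thesis
    using V_commute[OF u v] bracket_coset[OF e v]
    by (simp add: bracket_add_left bracket_add_right bracket_scale_left bracket_scale_right
        bracket_self)
qed

lemma abelian_inside: "W \<subseteq> V \<Longrightarrow> abelian W"
  by (auto simp: abelian_def intro: V_commute)

lemma subalgebra_inside: "subspace W \<Longrightarrow> W \<subseteq> V \<Longrightarrow> subalgebra W"
  by (auto simp: subalgebra_def V_commute subset_iff subspace_0)

lemma ideal_inside_iff:
  assumes W: "subspace W" "W \<subseteq> V"
  shows "ideal W UNIV \<longleftrightarrow> ad e0 ` W \<subseteq> W"
proof
  assume "ideal W UNIV"
  then show "ad e0 ` W \<subseteq> W"
    by (auto simp: ideal_def ad_def)
next
  assume inv: "ad e0 ` W \<subseteq> W"
  have "bracket x w \<in> W" if "w \<in> W" for x w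
  proof -
    obtain v c where v: "v \<in> V" "x = v + scale c e0"
      using decompose[OF e0_in_coset] .
    then have "bracket x w = scale c (ad e0 w)"
      using bracket_decomposed[OF e0_in_coset, of v w c 0] that W by auto
    then show ?thesis
      using inv that W(1) by (auto simp: subspace_scale)
  qed
  then show "ideal W UNIV"
    using W by (simp add: ideal_def)
qed

lemma generator_mem_plus_line: "subspace W \<Longrightarrow> e \<in> W + span {e}"
  unfolding mem_plus_line_iff by (intro bexI[of _ 0] exI[of _ 1]) (auto simp: subspace_0)

lemma mem_plus_line: "w \<in> W \<Longrightarrow> w \<in> W + span {e}"
  unfolding mem_plus_line_iff by (intro bexI[of _ w] exI[of _ 0]) auto

lemma subset_plus_line: "W \<subseteq> W + span {e}"
  by (auto intro: mem_plus_line)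

text \<open>
  Invariance is necessary because \<open>[e, w] = ad e\<^sub>0 w\<close> lies in \<open>V\<close>, and \<open>W \<oplus> \<bbbF>e\<close> meets \<open>V\<close> only in \<open>W\<close>.
\<close>
lemma subalgebra_plus_line_iff:
  assumes e: "e \<in> e0 +o V" and W: "subspace W" "W \<subseteq> V"
  shows "subalgebra (W + span {e}) \<longleftrightarrow> ad e0 ` W \<subseteq> W"
proof
  assume S: "subalgebra (W + span {e})"
  show "ad e0 ` W \<subseteq> W"
  proof (rule image_subsetI)
    fix w assume w: "w \<in> W"
    have "bracket e w \<in> W + span {e}"
      using S generator_mem_plus_line[OF W(1)] mem_plus_line[OF w] by (simp add: subalgebra_def)
    then show "ad e0 w \<in> W"
      using w W e by (auto simp: bracket_coset mem_plus_line_in_V_iff ad_in_V subset_iff)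
  qed
next
  assume inv: "ad e0 ` W \<subseteq> W"
  have "bracket x y \<in> W + span {e}" if xy: "x \<in> W + span {e}" "y \<in> W + span {e}" for x y
  proof -
    obtain u a v b where "u \<in> W" "x = u + scale a e" "v \<in> W" "y = v + scale b e"
      using xy by (auto simp: mem_plus_line_iff)
    then have "bracket x y \<in> W"
      using W inv
      by (auto simp: bracket_decomposed[OF e] subset_iff intro!: subspace_diff subspace_scale)
    then show ?thesis
      by (rule mem_plus_line)
  qed
  then show "subalgebra (W + span {e})"
    using subspace_plus_line[OF W(1)] by (simp add: subalgebra_def)
qed

text \<open>
  The generator \<open>e\<close> itself has to be multiplied into the ideal by all of \<open>V\<close>, so invariance of \<open>W\<close>
  has to be sharpened to \<open>ad e\<^sub>0 V \<subseteq> W\<close>.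
\<close>
lemma ideal_plus_line_iff:
  assumes e: "e \<in> e0 +o V" and W: "subspace W" "W \<subseteq> V"
  shows "ideal (W + span {e}) UNIV \<longleftrightarrow> ad e0 ` V \<subseteq> W"
proof
  assume I: "ideal (W + span {e}) UNIV"
  show "ad e0 ` V \<subseteq> W"
  proof (rule image_subsetI)
    fix v assume v: "v \<in> V"
    have "bracket v e \<in> W + span {e}"
      using I generator_mem_plus_line[OF W(1)] by (auto simp: ideal_def)
    moreover have "bracket v e = - ad e0 v"
      using bracket_skew[of v e] bracket_coset[OF e v] by simp
    ultimately have "- ad e0 v \<in> W"
      using mem_plus_line_in_V_iff[OF e W(2) subspace_neg[OF subspace_V ad_in_V[OF v]]] by simp
    then show "ad e0 v \<in> W"
      using subspace_neg[OF W(1)] by fastforce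
  qed
next
  assume im: "ad e0 ` V \<subseteq> W"
  have "bracket x y \<in> W + span {e}" if y: "y \<in> W + span {e}" for x y
  proof -
    obtain u a where u: "u \<in> V" "x = u + scale a e"
      using decompose[OF e] .
    obtain v b where "v \<in> W" "y = v + scale b e"
      using y by (auto simp: mem_plus_line_iff)
    with u have "bracket x y \<in> W"
      using W im
      by (auto simp: bracket_decomposed[OF e] subset_iff intro!: subspace_diff subspace_scale)
    then show ?thesis
      by (rule mem_plus_line)
  qed
  then show "ideal (W + span {e}) UNIV"
    using subspace_plus_line[OF W(1)] by (simp add: ideal_def)
qed

lemma subset_ker_ad_iff: "W \<subseteq> ker_ad V e0 \<longleftrightarrow> W \<subseteq> V \<and> (\<forall>w\<in>W. ad e0 w = 0)"
  by (auto simp: ker_ad_def)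

lemma subset_if_subset_ker_ad: "W \<subseteq> ker_ad V e0 \<Longrightarrow> W \<subseteq> V"
  by (simp add: subset_ker_ad_iff)

lemma abelian_plus_line_iff:
  assumes e: "e \<in> e0 +o V" and W: "subspace W" "W \<subseteq> V"
  shows "abelian (W + span {e}) \<longleftrightarrow> W \<subseteq> ker_ad V e0"
proof
  assume "abelian (W + span {e})"
  then have "ad e0 w = 0" if "w \<in> W" for w
    using that bracket_coset[OF e subsetD[OF W(2) that]]
      generator_mem_plus_line[OF W(1)] mem_plus_line[OF that]
    by (simp add: abelian_def)
  then show "W \<subseteq> ker_ad V e0"
    using W(2) by (auto simp: ker_ad_def)
next
  assume "W \<subseteq> ker_ad V e0"
  then have "w \<in> V \<and> ad e0 w = 0" if "w \<in> W" for w
    using that by (auto simp: subset_ker_ad_iff)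
  then show "abelian (W + span {e})"
    by (auto simp: abelian_def mem_plus_line_iff bracket_decomposed[OF e])
qed

lemma invariant_if_subset_ker_ad:
  "subspace W \<Longrightarrow> W \<subseteq> ker_ad V e0 \<Longrightarrow> ad e0 ` W \<subseteq> W"
  by (auto simp: subset_ker_ad_iff subspace_0)

text \<open>
  The sum is Abelian, so both summands commute with each other and with themselves; in particular the
  line \<open>\<bbbF>e\<close> is a subalgebra.
\<close>
lemma lie_direct_sum_plus_line:
  assumes e: "e \<in> e0 +o V" and W: "subspace W" "W \<subseteq> ker_ad V e0"
  shows "lie_direct_sum (W + span {e}) W (span {e})"
proof -
  have WV: "W \<subseteq> V"
    using W by (simp add: subset_ker_ad_iff)
  have ab: "abelian (W + span {e})"
    using abelian_plus_line_iff[OF e W(1) WV] W(2) by simp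
  have line: "span {e} \<subseteq> W + span {e}"
    using set_plus_mono3 subspace_0[OF W(1)] set_zero_plus2 by blast
  have "bracket x y = 0" if "x \<in> W + span {e}" "y \<in> span {e}" for x y
    using ab that line by (auto simp: abelian_def)
  then have comm: "bracket x y = 0" if "x \<in> W \<or> x \<in> span {e}" "y \<in> span {e}" for x y
    using that line mem_plus_line by blast
  have "subalgebra (span {e})"
    by (simp add: subalgebra_def comm span_zero)
  then show ?thesis
    using subalgebra_inside[OF W(1) WV] direct_sum_line[OF e W(1) WV] comm
    by (simp add: lie_direct_sum_def)
qed

lemma semidirect_plus_line:
  assumes e: "e \<in> e0 +o V" and W: "subspace W" "W \<subseteq> V" and inv: "ad e0 ` W \<subseteq> W"
  shows "semidirect (W + span {e}) W e"
proof -
  have "ideal W (W + span {e})"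
    using ideal_inside_iff[OF W] inv subset_plus_line by (auto simp: ideal_def)
  moreover have "e \<in> (W + span {e}) - W"
    using generator_mem_plus_line[OF W(1)] coset_notin_V[OF e] W(2) by auto
  ultimately show ?thesis
    using subalgebra_plus_line_iff[OF e W] inv abelian_inside[OF W(2)] codim1_line[OF e W]
      direct_sum_line[OF e W]
    by (simp add: semidirect_def)
qed

text \<open>\<open>W\<close> itself serves as the Abelian subalgebra of codimension 1.\<close>
lemma almost_abelian_plus_line:
  assumes e: "e \<in> e0 +o V" and W: "subspace W" "W \<subseteq> V"
    and inv: "ad e0 ` W \<subseteq> W" and "\<not> W \<subseteq> ker_ad V e0"
  shows "almost_abelian (W + span {e})"
  unfolding almost_abelian_def
  using assms subalgebra_plus_line_iff[OF e W] abelian_plus_line_iff[OF e W]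
    subalgebra_inside[OF W] abelian_inside[OF W(2)] codim1_line[OF e W] subset_plus_line
  by blast

section \<open>Classification of subalgebras and ideals\<close>

lemma subalgebra_classification:
  "subalgebra S \<longleftrightarrow>
    (\<exists>W. subspace W \<and> W \<subseteq> V \<and> S = W) \<or>
    (\<exists>e W. e \<in> e0 +o V \<and> subspace W \<and> W \<subseteq> ker_ad V e0 \<and> S = W + span {e}) \<or>
    (\<exists>e W. e \<in> e0 +o V \<and> subspace W \<and> W \<subseteq> V \<and> ad e0 ` W \<subseteq> W \<and>
      \<not> W \<subseteq> ker_ad V e0 \<and> S = W + span {e})" (is "_ \<longleftrightarrow> ?R")
proof
  assume S: "subalgebra S"
  then have "subspace S"
    by (simp add: subalgebra_def)
  then show ?R
  proof (cases rule: subspace_cases)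
    case inside
    with \<open>subspace S\<close> show ?thesis
      by blast
  next
    case (outside e W)
    with S have "ad e0 ` W \<subseteq> W"
      by (simp add: subalgebra_plus_line_iff)
    with outside show ?thesis
      by blast
  qed
next
  assume ?R
  then show "subalgebra S"
    by (elim disjE exE conjE)
      (simp_all add: subalgebra_inside subalgebra_plus_line_iff invariant_if_subset_ker_ad
        subset_if_subset_ker_ad)
qed

lemma ideal_classification:
  "ideal I UNIV \<longleftrightarrow>
    (\<exists>W. subspace W \<and> W \<subseteq> V \<and> ad e0 ` W \<subseteq> W \<and> I = W) \<or>
    (\<exists>e W. e \<in> e0 +o V \<and> subspace W \<and> W \<subseteq> ker_ad V e0 \<and> ad e0 ` V \<subseteq> W \<and>
      I = W + span {e}) \<or>
    (\<exists>e W. e \<in> e0 +o V \<and> subspace W \<and> W \<subseteq> V \<and> ad e0 ` V \<subseteq> W \<and>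
      \<not> W \<subseteq> ker_ad V e0 \<and> I = W + span {e})" (is "_ \<longleftrightarrow> ?R")
proof
  assume I: "ideal I UNIV"
  then have "subspace I"
    by (simp add: ideal_def)
  then show ?R
  proof (cases rule: subspace_cases)
    case inside
    with I \<open>subspace I\<close> have "ad e0 ` I \<subseteq> I"
      by (simp add: ideal_inside_iff)
    with inside \<open>subspace I\<close> show ?thesis
      by blast
  next
    case (outside e W)
    with I have "ad e0 ` V \<subseteq> W"
      by (simp add: ideal_plus_line_iff)
    with outside show ?thesis
      by blast
  qed
next
  assume ?R
  then show "ideal I UNIV"
    by (elim disjE exE conjE)
      (simp_all add: ideal_inside_iff ideal_plus_line_iff subset_if_subset_ker_ad)
qed

end

theorem proposition3:
  fixes scale :: "'a::field \<Rightarrow> 'b::ab_group_add \<Rightarrow> 'b"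
    and bracket :: "'b \<Rightarrow> 'b \<Rightarrow> 'b"
    and V :: "'b set"
    and e0 :: 'b
  assumes L: "lie_algebra scale bracket"
    and almost_abelian: "lie_algebra.almost_abelian scale bracket UNIV"
    and decomposition: "lie_algebra.semidirect scale bracket UNIV V e0"
  shows "
      (\<forall>L0. lie_algebra.subalgebra scale bracket L0 \<longleftrightarrow>
        (\<exists>W. module.subspace scale W \<and> W \<subseteq> V \<and> L0 = W) \<or>
        (\<exists>e1 W. e1 \<in> e0 +o V \<and> module.subspace scale W \<and>
          W \<subseteq> lie_algebra.ker_ad bracket V e0 \<and>
          L0 = W + module.span scale {e1}) \<or>
        (\<exists>e1 W. e1 \<in> e0 +o V \<and> module.subspace scale W \<and> W \<subseteq> V \<and>
          lie_algebra.ad bracket e0 ` W \<subseteq> W \<and> \<not> W \<subseteq> lie_algebra.ker_ad bracket V e0 \<and>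
          L0 = W + module.span scale {e1})) \<and>
      (\<forall>W. module.subspace scale W \<and> W \<subseteq> V \<longrightarrow>
        lie_algebra.subalgebra scale bracket W \<and> lie_algebra.abelian bracket W) \<and>
      (\<forall>e1 W. e1 \<in> e0 +o V \<and> module.subspace scale W \<and> W \<subseteq> lie_algebra.ker_ad bracket V e0 \<longrightarrow>
        lie_algebra.subalgebra scale bracket (W + module.span scale {e1}) \<and>
        lie_algebra.abelian bracket (W + module.span scale {e1}) \<and>
        lie_algebra.lie_direct_sum scale bracket
          (W + module.span scale {e1}) W (module.span scale {e1})) \<and>
      (\<forall>e1 W. e1 \<in> e0 +o V \<and> module.subspace scale W \<and> W \<subseteq> V \<and>
          lie_algebra.ad bracket e0 ` W \<subseteq> W \<and> \<not> W \<subseteq> lie_algebra.ker_ad bracket V e0 \<longrightarrow>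
        lie_algebra.subalgebra scale bracket (W + module.span scale {e1}) \<and>
        lie_algebra.almost_abelian scale bracket (W + module.span scale {e1}) \<and>
        lie_algebra.semidirect scale bracket (W + module.span scale {e1}) W e1) \<and>
      (\<forall>I. lie_algebra.ideal scale bracket I UNIV \<longleftrightarrow>
        (\<exists>W. module.subspace scale W \<and> W \<subseteq> V \<and> lie_algebra.ad bracket e0 ` W \<subseteq> W \<and> I = W) \<or>
        (\<exists>e1 W. e1 \<in> e0 +o V \<and> module.subspace scale W \<and>
          W \<subseteq> lie_algebra.ker_ad bracket V e0 \<and> lie_algebra.ad bracket e0 ` V \<subseteq> W \<and>
          I = W + module.span scale {e1}) \<or>
        (\<exists>e1 W. e1 \<in> e0 +o V \<and> module.subspace scale W \<and> W \<subseteq> V \<and>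
          lie_algebra.ad bracket e0 ` V \<subseteq> W \<and> \<not> W \<subseteq> lie_algebra.ker_ad bracket V e0 \<and>
          I = W + module.span scale {e1})) \<and>
      (\<forall>W. module.subspace scale W \<and> W \<subseteq> V \<and> lie_algebra.ad bracket e0 ` W \<subseteq> W \<longrightarrow>
        lie_algebra.ideal scale bracket W UNIV \<and> lie_algebra.abelian bracket W) \<and>
      (\<forall>e1 W. e1 \<in> e0 +o V \<and> module.subspace scale W \<and> W \<subseteq> lie_algebra.ker_ad bracket V e0 \<and>
          lie_algebra.ad bracket e0 ` V \<subseteq> W \<longrightarrow>
        lie_algebra.ideal scale bracket (W + module.span scale {e1}) UNIV \<and>
        lie_algebra.abelian bracket (W + module.span scale {e1}) \<and>
        lie_algebra.lie_direct_sum scale bracket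
          (W + module.span scale {e1}) W (module.span scale {e1})) \<and>
      (\<forall>e1 W. e1 \<in> e0 +o V \<and> module.subspace scale W \<and> W \<subseteq> V \<and>
          lie_algebra.ad bracket e0 ` V \<subseteq> W \<and> \<not> W \<subseteq> lie_algebra.ker_ad bracket V e0 \<longrightarrow>
        lie_algebra.ideal scale bracket (W + module.span scale {e1}) UNIV \<and>
        lie_algebra.almost_abelian scale bracket (W + module.span scale {e1}) \<and>
        lie_algebra.semidirect scale bracket (W + module.span scale {e1}) W e1)"
proof -
  interpret semidirect_decomposition scale bracket V e0
    using L decomposition
    by (simp add: semidirect_decomposition_def semidirect_decomposition_axioms_def)
  have invD: "ad e0 ` W \<subseteq> W" if "ad e0 ` V \<subseteq> W" "W \<subseteq> V" for W
    using that by blast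
  show ?thesis
    by (intro conjI allI impI subalgebra_classification ideal_classification; (elim conjE)?)
      (simp_all add: subalgebra_inside abelian_inside ideal_inside_iff subset_if_subset_ker_ad invD
        invariant_if_subset_ker_ad subalgebra_plus_line_iff abelian_plus_line_iff
        ideal_plus_line_iff lie_direct_sum_plus_line almost_abelian_plus_line
        semidirect_plus_line)
qed

end
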